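(* Let $M$ be an oriented neutral $4n$-manifold with metric $h$ and let $\nabla$ be the Levi-Civita connection of $h$. Let $\varepsilon\in\{+,-\}$ and let $J$ be an almost $\varepsilon$-paracomplex structure of $M$ such that $\nabla J$ is locally (near each point of $M$) represented as $\nabla J=\alpha\otimes N$ for a nowhere zero $1$-form $\alpha$ and an almost $\varepsilon$-nilpotent structure $N$ related to $J$ by some $(e,\mu)$, where $e$ is an admissible frame field of $J$ and $\mu\in\{+,-\}$. Let $\mathcal D_J$ be the light-like $2n$-dimensional distribution on $M$ given by $\nabla J$, i.e. $\mathcal D_J$ is locally the image $\mathrm{Im}\,N$. Then $(M,h,\mathcal D_J)$ is a Walker manifold.
   Context: Signs $\varepsilon,\mu\in\{+,-\}$ are identified with $\pm1$. $I_n$, $O_n$ are the $n\times n$ unit and zero matrices, $I_{n,+}:=I_n$, $I_{n,-}:=\mathrm{diag}(-1,1,\dots,1)$ (so $I_{1,-}=-1$), $I'_{4n,\varepsilon}:=\mathrm{diag}(I_n,I_n,I_n,I_{n,\varepsilon})$, and $$\Lambda_n:=\begin{bmatrix}O_n&-I_n&O_n&I_n\\ I_n&O_n&I_n&O_n\\ O_n&I_n&O_n&-I_n\\ I_n&O_n&I_n&O_n\end{bmatrix}.$$ A neutral metric $h$ on $M$ has signature $(2n,2n)$. An ordered pseudo-orthonormal local frame field $e=(e_1,\dots,e_{4n})$ of $TM$ has $e_1,\dots,e_{2n}$ space-like ($h(e_i,e_i)=1$) and $e_{2n+1},\dots,e_{4n}$ time-like ($h(e_i,e_i)=-1$). Frames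 are written as row vectors; endomorphisms act entrywise on a row. Almost $\varepsilon$-nilpotent structure (on an open set): a section $N$ of $\mathrm{End}\,TM$ such that near each point there is an ordered pseudo-orthonormal local frame field $e$ giving the orientation with $N(eI'_{4n,\varepsilon})=eI'_{4n,\varepsilon}\Lambda_n$; such an $e$ is an admissible frame field of $N$. Then $\mathrm{Im}\,N=\mathrm{Ker}\,N$ has rank $2n$ and is light-like (i.e. $h$ vanishes on it). Almost $\varepsilon$-paracomplex structure: a section $J$ of $\mathrm{End}\,TM$ such that (i) $J$ is an almost paracomplex structure ($J^2=\mathrm{id}$ with $\pm1$-eigenbundles of equal rank), (ii) $J$ is $h$-reversing: $h(JX,JY)=-h(X,Y)$, (iii) near each point there is an ordered pseudo-orthonormal local frame field $e$ giving the orientation with $$J(eI'_{4n,\varepsilon})=eI'_{4n,\varepsilon}\begin{bmatrix}O_n&O_n&I_n&O_n\\ O_n&O_n&O_n&-I_n\\ I_n&O_n&O_n&O_n\\ O_n&-I_n&O_n&O_n\end{bmatrix};$$ such an $e$ is an admissible frame field of $J$. For $\mu\in\{+,-\}$, $e(\mu):=(e_1,\dots,e_{2n},\mu e_{2n+1},\dots,\mu e_{4n})$. $N$ is related to $J$ by $(e,\mu)$ if $e$ is an admissible frame field of $J$ and $e(\mu)$ is an admissible frame field of $N$. For a light-like $2n$-dimensional distribution $\mathcal D$ on $M$, $(M,h,\mathcal D)$ is a Walker manifold if the covariant derivatives (with respect to $\nabla$) of local generators of $\mathcal D$ by any tangent vector of $M$ are contained in $\mathcal D$. *)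

theory Defs
  imports
    "HOL-Analysis.Analysis"
    "HOL-Library.Function_Algebras"
    "Jordan_Normal_Form.Determinant"
begin

section \<open>Pointwise vector space structure on functions\<close>

instantiation "fun" :: (type, real_vector) real_vector
begin

definition scaleR_fun :: "real \<Rightarrow> ('a \<Rightarrow> 'b) \<Rightarrow> 'a \<Rightarrow> 'b"
  where "scaleR_fun c f = (\<lambda>x. c *\<^sub>R f x)"

instance
  by standard (simp_all add: scaleR_fun_def fun_eq_iff algebra_simps)

end

section \<open>Smooth manifolds\<close>

text \<open>For functions on an open set \<open>S\<close>: \<open>k\<close> times continuously differentiable, via iterated
  partial derivatives.\<close>

primrec Ck_on :: "nat \<Rightarrow> ('b::euclidean_space \<Rightarrow> 'c::real_normed_vector) \<Rightarrow> 'b set \<Rightarrow> bool" where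
  "Ck_on 0 f S \<longleftrightarrow> continuous_on S f"
| "Ck_on (Suc k) f S \<longleftrightarrow> (\<forall>x\<in>S. f differentiable (at x)) \<and>
     (\<forall>b\<in>Basis. Ck_on k (\<lambda>x. frechet_derivative f (at x) b) S)"

definition smooth_on :: "'b::euclidean_space set \<Rightarrow> ('b \<Rightarrow> 'c::real_normed_vector) \<Rightarrow> bool" where
  "smooth_on S f \<longleftrightarrow> (\<forall>k. Ck_on k f S)"

text \<open>A chart is a pair of its domain and its coordinate map. The points of the manifold are the
  points of the topological space \<open>mtop\<close>. The atlas need not be maximal.\<close>

type_synonym ('a, 'b) chart = "'a set \<times> ('a \<Rightarrow> 'b)"

record ('a, 'b) smooth_mfd =
  mtop :: "'a topology"
  atlas :: "('a, 'b) chart set"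

definition is_chart :: "'a topology \<Rightarrow> ('a, 'b::euclidean_space) chart \<Rightarrow> bool" where
  "is_chart T = (\<lambda>(U, \<phi>). openin T U \<and> open (\<phi> ` U) \<and>
     homeomorphic_map (subtopology T U) (top_of_set (\<phi> ` U)) \<phi>)"

definition smooth_manifold :: "('a, 'b::euclidean_space) smooth_mfd \<Rightarrow> bool" where
  "smooth_manifold M \<longleftrightarrow>
     Hausdorff_space (mtop M) \<and> second_countable (mtop M) \<and>
     (\<forall>c\<in>atlas M. is_chart (mtop M) c) \<and>
     (\<Union>(U, \<phi>)\<in>atlas M. U) = topspace (mtop M) \<and>
     (\<forall>(U, \<phi>)\<in>atlas M. \<forall>(V, \<psi>)\<in>atlas M. smooth_on (\<phi> ` (U \<inter> V)) (\<psi> \<circ> inv_into U \<phi>))"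

definition smooth_fun :: "('a, 'b::euclidean_space) smooth_mfd \<Rightarrow> 'a set \<Rightarrow> ('a \<Rightarrow> real) \<Rightarrow> bool" where
  "smooth_fun M V f \<longleftrightarrow> (\<forall>(U, \<phi>)\<in>atlas M. smooth_on (\<phi> ` (U \<inter> V)) (f \<circ> inv_into U \<phi>))"

definition smooth_fun_at :: "('a, 'b::euclidean_space) smooth_mfd \<Rightarrow> 'a \<Rightarrow> ('a \<Rightarrow> real) \<Rightarrow> bool" where
  "smooth_fun_at M p f \<longleftrightarrow> (\<exists>V. openin (mtop M) V \<and> p \<in> V \<and> smooth_fun M V f)"

definition agree_near :: "('a, 'b) smooth_mfd \<Rightarrow> 'a \<Rightarrow> ('a \<Rightarrow> 'c) \<Rightarrow> ('a \<Rightarrow> 'c) \<Rightarrow> bool" where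
  "agree_near M p f g \<longleftrightarrow> (\<exists>V. openin (mtop M) V \<and> p \<in> V \<and> (\<forall>q\<in>V. f q = g q))"

section \<open>Tangent vectors and vector fields\<close>

text \<open>A tangent vector at \<open>p\<close> is a derivation of the algebra of germs at \<open>p\<close> of smooth functions.
  It is set to 0 on functions that are not smooth near \<open>p\<close>, so that equality of tangent vectors
  is equality of HOL functions.\<close>

type_synonym 'a tvec = "('a \<Rightarrow> real) \<Rightarrow> real"

definition tangent_space :: "('a, 'b::euclidean_space) smooth_mfd \<Rightarrow> 'a \<Rightarrow> 'a tvec set" where
  "tangent_space M p = {v.
     (\<forall>f. \<not> smooth_fun_at M p f \<longrightarrow> v f = 0) \<and>
     (\<forall>f g. smooth_fun_at M p f \<and> smooth_fun_at M p g \<and> agree_near M p f g \<longrightarrow> v f = v g) \<and>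
     (\<forall>f g. smooth_fun_at M p f \<and> smooth_fun_at M p g \<longrightarrow>
        v (\<lambda>q. f q + g q) = v f + v g \<and>
        v (\<lambda>q. f q * g q) = f p * v g + g p * v f) \<and>
     (\<forall>c f. smooth_fun_at M p f \<longrightarrow> v (\<lambda>q. c * f q) = c * v f)}"

type_synonym 'a vfield = "'a \<Rightarrow> 'a tvec"

definition smooth_vfield :: "('a, 'b::euclidean_space) smooth_mfd \<Rightarrow> 'a set \<Rightarrow> 'a vfield \<Rightarrow> bool" where
  "smooth_vfield M U X \<longleftrightarrow> (\<forall>p\<in>U. X p \<in> tangent_space M p) \<and>
     (\<forall>V f. openin (mtop M) V \<and> V \<subseteq> U \<and> smooth_fun M V f \<longrightarrow> smooth_fun M V (\<lambda>p. X p f))"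

definition smooth_vfield_at :: "('a, 'b::euclidean_space) smooth_mfd \<Rightarrow> 'a \<Rightarrow> 'a vfield \<Rightarrow> bool" where
  "smooth_vfield_at M p X \<longleftrightarrow> (\<exists>U. openin (mtop M) U \<and> p \<in> U \<and> smooth_vfield M U X)"

definition lie_bracket ::
  "('a, 'b::euclidean_space) smooth_mfd \<Rightarrow> 'a vfield \<Rightarrow> 'a vfield \<Rightarrow> 'a vfield" where
  "lie_bracket M X Y p = (\<lambda>f. if smooth_fun_at M p f
     then X p (\<lambda>q. Y q f) - Y p (\<lambda>q. X q f) else 0)"

definition smooth_one_form ::
  "('a, 'b::euclidean_space) smooth_mfd \<Rightarrow> 'a set \<Rightarrow> ('a \<Rightarrow> 'a tvec \<Rightarrow> real) \<Rightarrow> bool" where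
  "smooth_one_form M U \<alpha> \<longleftrightarrow>
     (\<forall>p\<in>U. \<forall>v\<in>tangent_space M p. \<forall>w\<in>tangent_space M p. \<forall>a b.
        \<alpha> p (a *\<^sub>R v + b *\<^sub>R w) = a * \<alpha> p v + b * \<alpha> p w) \<and>
     (\<forall>V X. openin (mtop M) V \<and> V \<subseteq> U \<and> smooth_vfield M V X \<longrightarrow> smooth_fun M V (\<lambda>p. \<alpha> p (X p)))"

definition nowhere_zero ::
  "('a, 'b::euclidean_space) smooth_mfd \<Rightarrow> 'a set \<Rightarrow> ('a \<Rightarrow> 'a tvec \<Rightarrow> real) \<Rightarrow> bool" where
  "nowhere_zero M U \<alpha> \<longleftrightarrow> (\<forall>p\<in>U. \<exists>v\<in>tangent_space M p. \<alpha> p v \<noteq> 0)"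

text \<open>Smooth sections of \<open>End TM\<close> over \<open>U\<close>.\<close>

definition endo_section ::
  "('a, 'b::euclidean_space) smooth_mfd \<Rightarrow> 'a set \<Rightarrow> ('a \<Rightarrow> 'a tvec \<Rightarrow> 'a tvec) \<Rightarrow> bool" where
  "endo_section M U F \<longleftrightarrow>
     (\<forall>p\<in>U. \<forall>v\<in>tangent_space M p. F p v \<in> tangent_space M p) \<and>
     (\<forall>p\<in>U. \<forall>v\<in>tangent_space M p. \<forall>w\<in>tangent_space M p. \<forall>a b.
        F p (a *\<^sub>R v + b *\<^sub>R w) = a *\<^sub>R F p v + b *\<^sub>R F p w) \<and>
     (\<forall>V X. openin (mtop M) V \<and> V \<subseteq> U \<and> smooth_vfield M V X \<longrightarrow>
        smooth_vfield M V (\<lambda>p. F p (X p)))"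

section \<open>Frames, orientation, neutral metrics\<close>

definition ordered_basis :: "nat \<Rightarrow> (nat \<Rightarrow> 'v::real_vector) \<Rightarrow> 'v set \<Rightarrow> bool" where
  "ordered_basis k e S \<longleftrightarrow>
     inj_on e {..<k} \<and> independent (e ` {..<k}) \<and> span (e ` {..<k}) = S"

text \<open>Frames and their members are numbered from 0: the local frame field
  \<open>(e\<^sub>1, \<dots>, e\<^sub>k)\<close> is \<open>(e 0, \<dots>, e (k - 1))\<close>.\<close>

definition frame_field ::
  "('a, 'b::euclidean_space) smooth_mfd \<Rightarrow> 'a set \<Rightarrow> nat \<Rightarrow> (nat \<Rightarrow> 'a vfield) \<Rightarrow> bool" where
  "frame_field M U k e \<longleftrightarrow> (\<forall>i<k. smooth_vfield M U (e i)) \<and>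
     (\<forall>p\<in>U. ordered_basis k (\<lambda>i. e i p) (tangent_space M p))"

definition same_orientation :: "nat \<Rightarrow> (nat \<Rightarrow> 'v::real_vector) \<Rightarrow> (nat \<Rightarrow> 'v) \<Rightarrow> bool" where
  "same_orientation k e f \<longleftrightarrow> (\<exists>A\<in>carrier_mat k k. Determinant.det A > 0 \<and>
     (\<forall>j<k. f j = (\<Sum>i<k. (A $$ (i, j)) *\<^sub>R e i)))"

text \<open>An orientation assigns to each point \<open>p\<close> one of the two classes of ordered bases of the
  tangent space at \<open>p\<close>, such that near each point the choice is represented by a local
  frame field.\<close>

definition orientation ::
  "('a, 'b::euclidean_space) smooth_mfd \<Rightarrow> nat \<Rightarrow> ('a \<Rightarrow> (nat \<Rightarrow> 'a tvec) set) \<Rightarrow> bool" where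
  "orientation M k Or \<longleftrightarrow>
     (\<forall>p\<in>topspace (mtop M). \<exists>e. ordered_basis k e (tangent_space M p) \<and>
        Or p = {f. ordered_basis k f (tangent_space M p) \<and> same_orientation k e f}) \<and>
     (\<forall>p\<in>topspace (mtop M). \<exists>U e. openin (mtop M) U \<and> p \<in> U \<and> frame_field M U k e \<and>
        (\<forall>q\<in>U. (\<lambda>i. e i q) \<in> Or q))"

definition pseudo_orthonormal :: "nat \<Rightarrow> ('v \<Rightarrow> 'v \<Rightarrow> real) \<Rightarrow> (nat \<Rightarrow> 'v) \<Rightarrow> bool" where
  "pseudo_orthonormal n g e \<longleftrightarrow> (\<forall>i<4*n. \<forall>j<4*n.
     g (e i) (e j) = (if i \<noteq> j then 0 else if i < 2*n then 1 else -1))"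

definition neutral_metric ::
  "('a, 'b::euclidean_space) smooth_mfd \<Rightarrow> nat \<Rightarrow> ('a \<Rightarrow> 'a tvec \<Rightarrow> 'a tvec \<Rightarrow> real) \<Rightarrow> bool" where
  "neutral_metric M n h \<longleftrightarrow>
     (\<forall>p\<in>topspace (mtop M). \<forall>u\<in>tangent_space M p. \<forall>v\<in>tangent_space M p. \<forall>w\<in>tangent_space M p. \<forall>a b.
        h p u v = h p v u \<and>
        h p (a *\<^sub>R u + b *\<^sub>R v) w = a * h p u w + b * h p v w) \<and>
     (\<forall>U X Y. openin (mtop M) U \<and> smooth_vfield M U X \<and> smooth_vfield M U Y \<longrightarrow>
        smooth_fun M U (\<lambda>p. h p (X p) (Y p))) \<and>
     (\<forall>p\<in>topspace (mtop M). \<exists>e. ordered_basis (4*n) e (tangent_space M p) \<and>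
        pseudo_orthonormal n (h p) e)"

text \<open>Ordered pseudo-orthonormal local frame fields giving the orientation.\<close>

definition po_frame_field ::
  "('a, 'b::euclidean_space) smooth_mfd \<Rightarrow> nat \<Rightarrow> ('a \<Rightarrow> 'a tvec \<Rightarrow> 'a tvec \<Rightarrow> real) \<Rightarrow>
   ('a \<Rightarrow> (nat \<Rightarrow> 'a tvec) set) \<Rightarrow> 'a set \<Rightarrow> (nat \<Rightarrow> 'a vfield) \<Rightarrow> bool" where
  "po_frame_field M n h Or U e \<longleftrightarrow> frame_field M U (4*n) e \<and>
     (\<forall>p\<in>U. pseudo_orthonormal n (h p) (\<lambda>i. e i p) \<and> (\<lambda>i. e i p) \<in> Or p)"

section \<open>The Levi-Civita connection\<close>

text \<open>A connection is a function \<open>nab\<close>, where \<open>nab p v Y\<close> is \<open>\<nabla>\<^sub>v Y\<close> for a tangent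
  vector \<open>v\<close> at \<open>p\<close> and a vector field \<open>Y\<close> which is smooth near \<open>p\<close>; it depends only on the
  germ of \<open>Y\<close> at \<open>p\<close>. The covariant derivative of \<open>Y\<close> along a vector field \<open>X\<close> is
  \<open>\<lambda>p. nab p (X p) Y\<close>.\<close>

type_synonym 'a connection = "'a \<Rightarrow> 'a tvec \<Rightarrow> 'a vfield \<Rightarrow> 'a tvec"

definition affine_connection ::
  "('a, 'b::euclidean_space) smooth_mfd \<Rightarrow> 'a connection \<Rightarrow> bool" where
  "affine_connection M nab \<longleftrightarrow>
     (\<forall>p\<in>topspace (mtop M). \<forall>v\<in>tangent_space M p. \<forall>Y. smooth_vfield_at M p Y \<longrightarrow>
        nab p v Y \<in> tangent_space M p) \<and>
     (\<forall>p\<in>topspace (mtop M). \<forall>v\<in>tangent_space M p. \<forall>Y Z.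
        smooth_vfield_at M p Y \<and> smooth_vfield_at M p Z \<and> agree_near M p Y Z \<longrightarrow>
        nab p v Y = nab p v Z) \<and>
     (\<forall>p\<in>topspace (mtop M). \<forall>v\<in>tangent_space M p. \<forall>w\<in>tangent_space M p. \<forall>a b Y.
        smooth_vfield_at M p Y \<longrightarrow>
        nab p (a *\<^sub>R v + b *\<^sub>R w) Y = a *\<^sub>R nab p v Y + b *\<^sub>R nab p w Y) \<and>
     (\<forall>p\<in>topspace (mtop M). \<forall>v\<in>tangent_space M p. \<forall>Y Z.
        smooth_vfield_at M p Y \<and> smooth_vfield_at M p Z \<longrightarrow>
        nab p v (\<lambda>q. Y q + Z q) = nab p v Y + nab p v Z) \<and>
     (\<forall>p\<in>topspace (mtop M). \<forall>v\<in>tangent_space M p. \<forall>f Y.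
        smooth_fun_at M p f \<and> smooth_vfield_at M p Y \<longrightarrow>
        nab p v (\<lambda>q. f q *\<^sub>R Y q) = v f *\<^sub>R Y p + f p *\<^sub>R nab p v Y) \<and>
     (\<forall>U X Y. openin (mtop M) U \<and> smooth_vfield M U X \<and> smooth_vfield M U Y \<longrightarrow>
        smooth_vfield M U (\<lambda>p. nab p (X p) Y))"

definition levi_civita ::
  "('a, 'b::euclidean_space) smooth_mfd \<Rightarrow> ('a \<Rightarrow> 'a tvec \<Rightarrow> 'a tvec \<Rightarrow> real) \<Rightarrow>
   'a connection \<Rightarrow> bool" where
  "levi_civita M h nab \<longleftrightarrow> affine_connection M nab \<and>
     (\<forall>p\<in>topspace (mtop M). \<forall>v\<in>tangent_space M p. \<forall>Y Z.
        smooth_vfield_at M p Y \<and> smooth_vfield_at M p Z \<longrightarrow>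
        v (\<lambda>q. h q (Y q) (Z q)) = h p (nab p v Y) (Z p) + h p (Y p) (nab p v Z)) \<and>
     (\<forall>p\<in>topspace (mtop M). \<forall>X Y.
        smooth_vfield_at M p X \<and> smooth_vfield_at M p Y \<longrightarrow>
        nab p (X p) Y - nab p (Y p) X = lie_bracket M X Y p)"

text \<open>The vector \<open>(\<nabla>\<^sub>v F) (W p)\<close> for a section \<open>F\<close> of \<open>End TM\<close>.\<close>

definition covD_endo ::
  "'a connection \<Rightarrow> ('a \<Rightarrow> 'a tvec \<Rightarrow> 'a tvec) \<Rightarrow> 'a \<Rightarrow> 'a tvec \<Rightarrow> 'a vfield \<Rightarrow> 'a tvec" where
  "covD_endo nab F p v W = nab p v (\<lambda>q. F q (W q)) - F p (nab p v W)"

section \<open>Almost \<open>\<epsilon>\<close>-nilpotent and almost \<open>\<epsilon>\<close>-paracomplex structures\<close>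

text \<open>Signs are the real numbers \<open>1\<close> and \<open>-1\<close>.\<close>

definition I_sgn :: "nat \<Rightarrow> real \<Rightarrow> real mat" where
  "I_sgn n \<epsilon> = mat n n (\<lambda>(i, j). if i \<noteq> j then 0 else if i = 0 then \<epsilon> else 1)"

definition I'_sgn :: "nat \<Rightarrow> real \<Rightarrow> real mat" where
  "I'_sgn n \<epsilon> = four_block_mat
     (1\<^sub>m (2*n)) (0\<^sub>m (2*n) (2*n))
     (0\<^sub>m (2*n) (2*n)) (four_block_mat (1\<^sub>m n) (0\<^sub>m n n) (0\<^sub>m n n) (I_sgn n \<epsilon>))"

definition Lambda_mat :: "nat \<Rightarrow> real mat" where
  "Lambda_mat n = four_block_mat
     (four_block_mat (0\<^sub>m n n) (- 1\<^sub>m n) (1\<^sub>m n) (0\<^sub>m n n))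
     (four_block_mat (0\<^sub>m n n) (1\<^sub>m n) (1\<^sub>m n) (0\<^sub>m n n))
     (four_block_mat (0\<^sub>m n n) (1\<^sub>m n) (1\<^sub>m n) (0\<^sub>m n n))
     (four_block_mat (0\<^sub>m n n) (- 1\<^sub>m n) (1\<^sub>m n) (0\<^sub>m n n))"

definition paracomplex_mat :: "nat \<Rightarrow> real mat" where
  "paracomplex_mat n = four_block_mat
     (0\<^sub>m (2*n) (2*n)) (four_block_mat (1\<^sub>m n) (0\<^sub>m n n) (0\<^sub>m n n) (- 1\<^sub>m n))
     (four_block_mat (1\<^sub>m n) (0\<^sub>m n n) (0\<^sub>m n n) (- 1\<^sub>m n)) (0\<^sub>m (2*n) (2*n))"

text \<open>The product of a row of \<open>k\<close> vector fields with a matrix that has \<open>k\<close> rows.\<close>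

definition row_mult :: "nat \<Rightarrow> (nat \<Rightarrow> 'a vfield) \<Rightarrow> real mat \<Rightarrow> nat \<Rightarrow> 'a vfield" where
  "row_mult k e A = (\<lambda>j p. \<Sum>i<k. (A $$ (i, j)) *\<^sub>R e i p)"

text \<open>\<open>e\<close> is an ordered pseudo-orthonormal frame field over \<open>U\<close> giving the orientation, with
  \<open>F(e I') = (e I') A\<close>, where \<open>I' = I'\<^bsub>4n,\<epsilon>\<^esub>\<close>.\<close>

definition adapted_frame ::
  "('a, 'b::euclidean_space) smooth_mfd \<Rightarrow> nat \<Rightarrow> ('a \<Rightarrow> 'a tvec \<Rightarrow> 'a tvec \<Rightarrow> real) \<Rightarrow>
   ('a \<Rightarrow> (nat \<Rightarrow> 'a tvec) set) \<Rightarrow> real \<Rightarrow> real mat \<Rightarrow> 'a set \<Rightarrow>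
   ('a \<Rightarrow> 'a tvec \<Rightarrow> 'a tvec) \<Rightarrow> (nat \<Rightarrow> 'a vfield) \<Rightarrow> bool" where
  "adapted_frame M n h Or \<epsilon> A U F e \<longleftrightarrow> po_frame_field M n h Or U e \<and>
     (\<forall>p\<in>U. \<forall>j<4*n. F p (row_mult (4*n) e (I'_sgn n \<epsilon>) j p) =
        row_mult (4*n) (row_mult (4*n) e (I'_sgn n \<epsilon>)) A j p)"

abbreviation nilpotent_admissible where
  "nilpotent_admissible M n h Or \<epsilon> U N e \<equiv> adapted_frame M n h Or \<epsilon> (Lambda_mat n) U N e"

abbreviation paracomplex_admissible where
  "paracomplex_admissible M n h Or \<epsilon> U J e \<equiv> adapted_frame M n h Or \<epsilon> (paracomplex_mat n) U J e"

definition almost_nilpotent ::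
  "('a, 'b::euclidean_space) smooth_mfd \<Rightarrow> nat \<Rightarrow> ('a \<Rightarrow> 'a tvec \<Rightarrow> 'a tvec \<Rightarrow> real) \<Rightarrow>
   ('a \<Rightarrow> (nat \<Rightarrow> 'a tvec) set) \<Rightarrow> real \<Rightarrow> 'a set \<Rightarrow> ('a \<Rightarrow> 'a tvec \<Rightarrow> 'a tvec) \<Rightarrow> bool" where
  "almost_nilpotent M n h Or \<epsilon> U N \<longleftrightarrow> endo_section M U N \<and>
     (\<forall>p\<in>U. \<exists>V e. openin (mtop M) V \<and> p \<in> V \<and> V \<subseteq> U \<and> nilpotent_admissible M n h Or \<epsilon> V N e)"

definition almost_paracomplex ::
  "('a, 'b::euclidean_space) smooth_mfd \<Rightarrow> 'a set \<Rightarrow> ('a \<Rightarrow> 'a tvec \<Rightarrow> 'a tvec) \<Rightarrow> bool" where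
  "almost_paracomplex M U J \<longleftrightarrow> endo_section M U J \<and>
     (\<forall>p\<in>U. (\<forall>v\<in>tangent_space M p. J p (J p v) = v) \<and>
        dim {v \<in> tangent_space M p. J p v = v} = dim {v \<in> tangent_space M p. J p v = - v})"

definition almost_eps_paracomplex ::
  "('a, 'b::euclidean_space) smooth_mfd \<Rightarrow> nat \<Rightarrow> ('a \<Rightarrow> 'a tvec \<Rightarrow> 'a tvec \<Rightarrow> real) \<Rightarrow>
   ('a \<Rightarrow> (nat \<Rightarrow> 'a tvec) set) \<Rightarrow> real \<Rightarrow> ('a \<Rightarrow> 'a tvec \<Rightarrow> 'a tvec) \<Rightarrow> bool" where
  "almost_eps_paracomplex M n h Or \<epsilon> J \<longleftrightarrow>
     almost_paracomplex M (topspace (mtop M)) J \<and>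
     (\<forall>p\<in>topspace (mtop M). \<forall>v\<in>tangent_space M p. \<forall>w\<in>tangent_space M p.
        h p (J p v) (J p w) = - h p v w) \<and>
     (\<forall>p\<in>topspace (mtop M). \<exists>U e. openin (mtop M) U \<and> p \<in> U \<and>
        paracomplex_admissible M n h Or \<epsilon> U J e)"

text \<open>The frame field \<open>e(\<mu>)\<close>.\<close>

definition frame_sgn :: "nat \<Rightarrow> real \<Rightarrow> (nat \<Rightarrow> 'a vfield) \<Rightarrow> nat \<Rightarrow> 'a vfield" where
  "frame_sgn n \<mu> e = (\<lambda>i p. if i < 2*n then e i p else \<mu> *\<^sub>R e i p)"

definition related_by ::
  "('a, 'b::euclidean_space) smooth_mfd \<Rightarrow> nat \<Rightarrow> ('a \<Rightarrow> 'a tvec \<Rightarrow> 'a tvec \<Rightarrow> real) \<Rightarrow>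
   ('a \<Rightarrow> (nat \<Rightarrow> 'a tvec) set) \<Rightarrow> real \<Rightarrow> 'a set \<Rightarrow> ('a \<Rightarrow> 'a tvec \<Rightarrow> 'a tvec) \<Rightarrow>
   ('a \<Rightarrow> 'a tvec \<Rightarrow> 'a tvec) \<Rightarrow> (nat \<Rightarrow> 'a vfield) \<Rightarrow> real \<Rightarrow> bool" where
  "related_by M n h Or \<epsilon> U N J e \<mu> \<longleftrightarrow>
     paracomplex_admissible M n h Or \<epsilon> U J e \<and>
     nilpotent_admissible M n h Or \<epsilon> U N (frame_sgn n \<mu> e)"

text \<open>A local representation \<open>\<nabla>J = \<alpha> \<otimes> N\<close> over \<open>U\<close>. Since it is only required near each point,
  \<open>U\<close> is taken so small that the frame field relating \<open>N\<close> to \<open>J\<close> is defined on all of \<open>U\<close>.\<close>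

definition nabla_repr ::
  "('a, 'b::euclidean_space) smooth_mfd \<Rightarrow> nat \<Rightarrow> ('a \<Rightarrow> 'a tvec \<Rightarrow> 'a tvec \<Rightarrow> real) \<Rightarrow>
   ('a \<Rightarrow> (nat \<Rightarrow> 'a tvec) set) \<Rightarrow> 'a connection \<Rightarrow> real \<Rightarrow> ('a \<Rightarrow> 'a tvec \<Rightarrow> 'a tvec) \<Rightarrow>
   'a set \<Rightarrow> ('a \<Rightarrow> 'a tvec \<Rightarrow> real) \<Rightarrow> ('a \<Rightarrow> 'a tvec \<Rightarrow> 'a tvec) \<Rightarrow> bool" where
  "nabla_repr M n h Or nab \<epsilon> J U \<alpha> N \<longleftrightarrow>
     openin (mtop M) U \<and>
     smooth_one_form M U \<alpha> \<and> nowhere_zero M U \<alpha> \<and>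
     almost_nilpotent M n h Or \<epsilon> U N \<and>
     (\<exists>e. \<exists>\<mu>\<in>{1, -1}. related_by M n h Or \<epsilon> U N J e \<mu>) \<and>
     (\<forall>p\<in>U. \<forall>v\<in>tangent_space M p. \<forall>W. smooth_vfield_at M p W \<longrightarrow>
        covD_endo nab J p v W = \<alpha> p v *\<^sub>R N p (W p))"

text \<open>The distribution given locally as \<open>Im N\<close>. Since \<open>\<alpha>\<close> is nowhere zero, \<open>Im N\<close> at \<open>p\<close> is
  the same for all local representations \<open>\<nabla>J = \<alpha> \<otimes> N\<close> near \<open>p\<close>, so that the union below is
  a union of equal sets.\<close>

definition nabla_distribution ::
  "('a, 'b::euclidean_space) smooth_mfd \<Rightarrow> nat \<Rightarrow> ('a \<Rightarrow> 'a tvec \<Rightarrow> 'a tvec \<Rightarrow> real) \<Rightarrow>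
   ('a \<Rightarrow> (nat \<Rightarrow> 'a tvec) set) \<Rightarrow> 'a connection \<Rightarrow> real \<Rightarrow> ('a \<Rightarrow> 'a tvec \<Rightarrow> 'a tvec) \<Rightarrow>
   'a \<Rightarrow> 'a tvec set" where
  "nabla_distribution M n h Or nab \<epsilon> J p =
     \<Union>{N p ` tangent_space M p | U \<alpha> N. p \<in> U \<and> nabla_repr M n h Or nab \<epsilon> J U \<alpha> N}"

section \<open>Walker manifolds\<close>

definition local_generators ::
  "('a, 'b::euclidean_space) smooth_mfd \<Rightarrow> 'a set \<Rightarrow> nat \<Rightarrow> (nat \<Rightarrow> 'a vfield) \<Rightarrow>
   ('a \<Rightarrow> 'a tvec set) \<Rightarrow> bool" where
  "local_generators M U k \<xi> D \<longleftrightarrow> openin (mtop M) U \<and> (\<forall>i<k. smooth_vfield M U (\<xi> i)) \<and>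
     (\<forall>p\<in>U. ordered_basis k (\<lambda>i. \<xi> i p) (D p))"

definition distribution ::
  "('a, 'b::euclidean_space) smooth_mfd \<Rightarrow> nat \<Rightarrow> ('a \<Rightarrow> 'a tvec set) \<Rightarrow> bool" where
  "distribution M k D \<longleftrightarrow>
     (\<forall>p\<in>topspace (mtop M). \<exists>U \<xi>. p \<in> U \<and> local_generators M U k \<xi> D)"

definition light_like ::
  "('a, 'b::euclidean_space) smooth_mfd \<Rightarrow> ('a \<Rightarrow> 'a tvec \<Rightarrow> 'a tvec \<Rightarrow> real) \<Rightarrow>
   ('a \<Rightarrow> 'a tvec set) \<Rightarrow> bool" where
  "light_like M h D \<longleftrightarrow> (\<forall>p\<in>topspace (mtop M). \<forall>v\<in>D p. \<forall>w\<in>D p. h p v w = 0)"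

definition walker_manifold ::
  "('a, 'b::euclidean_space) smooth_mfd \<Rightarrow> nat \<Rightarrow> ('a \<Rightarrow> 'a tvec \<Rightarrow> 'a tvec \<Rightarrow> real) \<Rightarrow>
   'a connection \<Rightarrow> ('a \<Rightarrow> 'a tvec set) \<Rightarrow> bool" where
  "walker_manifold M n h nab D \<longleftrightarrow>
     distribution M (2*n) D \<and> light_like M h D \<and>
     (\<forall>U \<xi>. local_generators M U (2*n) \<xi> D \<longrightarrow>
        (\<forall>p\<in>U. \<forall>v\<in>tangent_space M p. \<forall>i<2*n. nab p v (\<xi> i) \<in> D p))"

end

theory Submission
  imports Defs
begin

text \<open>
  In a frame relating \<open>N\<close> to \<open>J\<close> one reads off that \<open>Im N = Ker N\<close> is the eigenspace of \<open>J\<close>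
  for the eigenvalue \<open>-\<mu>\<close>. It is light-like because \<open>J\<close> reverses \<open>h\<close>. If \<open>W\<close> is a local section
  of it, then \<open>\<nabla>\<^sub>v(J W) - J (\<nabla>\<^sub>v W) = \<alpha>(v) N W = 0\<close> and \<open>J W = -\<mu> W\<close>, so \<open>\<nabla>\<^sub>v W\<close> lies in
  the same eigenspace. The images of \<open>N\<close> for different representations \<open>\<nabla>J = \<alpha> \<otimes> N\<close> agree since
  \<open>\<alpha>\<close> has no zeros.
\<close>

section \<open>Smoothness on open sets\<close>

text \<open>Openness of \<open>S\<close> is essential: functions that agree on \<open>S\<close>
  agree near each of its points, so they have the same Frechet derivatives there, and the induction
  passes to the partial derivatives.\<close>

lemma Ck_on_cong:
  fixes f g :: "'b::euclidean_space \<Rightarrow> 'c::real_normed_vector"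
  assumes "open S" "\<And>x. x \<in> S \<Longrightarrow> f x = g x" "Ck_on k f S"
  shows "Ck_on k g S"
  using assms(2,3)
proof (induction k arbitrary: f g)
  case 0
  then show ?case by (simp cong: continuous_on_cong)
next
  case (Suc k)
  have "g differentiable (at x) \<and> frechet_derivative f (at x) = frechet_derivative g (at x)"
    if "x \<in> S" for x
  proof -
    have "(f has_derivative frechet_derivative f (at x)) (at x)"
      using Suc.prems(2) that frechet_derivative_works by auto
    then have *: "(g has_derivative frechet_derivative f (at x)) (at x)"
      using has_derivative_transform_within_open[OF _ \<open>open S\<close> that] Suc.prems(1) by blast
    then show ?thesis
      using frechet_derivative_at differentiable_def by blast
  qed
  moreover have "Ck_on k (\<lambda>x. frechet_derivative g (at x) b) S" if "b \<in> Basis" for b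
    by (rule Suc.IH[of "\<lambda>x. frechet_derivative f (at x) b"])
      (use Suc.prems(2) that calculation in auto)
  ultimately show ?case by simp
qed

lemma Ck_on_const: "Ck_on k (\<lambda>x. c) S"
  by (induction k arbitrary: c) simp_all

text \<open>Openness of the chart image allows \<open>Ck_on_cong\<close> to be applied in
  coordinates, and injectivity makes \<open>inv_into U \<phi>\<close> a genuine inverse of
  \<open>\<phi>\<close> on the chart.\<close>

lemma open_chart_image:
  assumes "smooth_manifold M" "(U, \<phi>) \<in> atlas M" "openin (mtop M) V"
  shows "open (\<phi> ` (U \<inter> V))" "inj_on \<phi> U"
proof -
  have c: "openin (mtop M) U" "open (\<phi> ` U)"
    "homeomorphic_map (subtopology (mtop M) U) (top_of_set (\<phi> ` U)) \<phi>"
    using assms unfolding smooth_manifold_def is_chart_def by auto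
  have "openin (subtopology (mtop M) U) (U \<inter> V)"
    using assms(3) by (auto simp: openin_subtopology)
  then have "openin (top_of_set (\<phi> ` U)) (\<phi> ` (U \<inter> V))"
    using homeomorphic_imp_open_map[OF c(3)] unfolding open_map_def by blast
  then show "open (\<phi> ` (U \<inter> V))"
    using c(2) openin_open_trans by blast
  have "topspace (subtopology (mtop M) U) = U"
    using c(1) openin_subset by fastforce
  then show "inj_on \<phi> U"
    using homeomorphic_imp_injective_map[OF c(3)] by simp
qed

lemma smooth_fun_cong:
  assumes M: "smooth_manifold M" and V: "openin (mtop M) V"
    and eq: "\<And>p. p \<in> V \<Longrightarrow> f p = g p" and f: "smooth_fun M V f"
  shows "smooth_fun M V g"
  unfolding smooth_fun_def
proof clarify
  fix U \<phi> assume c: "(U, \<phi>) \<in> atlas M"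
  note * = open_chart_image[OF M c V]
  have "(f \<circ> inv_into U \<phi>) x = (g \<circ> inv_into U \<phi>) x" if "x \<in> \<phi> ` (U \<inter> V)" for x
    using that eq *(2) by (auto simp: inv_into_f_f)
  then show "smooth_on (\<phi> ` (U \<inter> V)) (g \<circ> inv_into U \<phi>)"
    using f c Ck_on_cong[OF *(1)] unfolding smooth_fun_def smooth_on_def by blast
qed

lemma smooth_fun_const: "smooth_fun M V (\<lambda>p. c)"
  by (auto simp: smooth_fun_def smooth_on_def o_def Ck_on_const)

lemma smooth_vfield_subset:
  assumes "smooth_vfield M U X" "V \<subseteq> U"
  shows "smooth_vfield M V X"
  using assms unfolding smooth_vfield_def by blast

lemma smooth_vfield_cong:
  assumes "smooth_manifold M" "\<And>p. p \<in> U \<Longrightarrow> X p = Y p" "smooth_vfield M U X"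
  shows "smooth_vfield M U Y"
  unfolding smooth_vfield_def
proof (intro conjI ballI allI impI)
  show "Y p \<in> tangent_space M p" if "p \<in> U" for p
    using assms that unfolding smooth_vfield_def by metis
  show "smooth_fun M V (\<lambda>p. Y p f)" if "openin (mtop M) V \<and> V \<subseteq> U \<and> smooth_fun M V f" for V f
  proof (rule smooth_fun_cong[OF assms(1)])
    show "X p f = Y p f" if "p \<in> V" for p
      using that \<open>_ \<and> _ \<and> _\<close> assms(2) by (metis subsetD)
  qed (use that assms(3) in \<open>auto simp: smooth_vfield_def\<close>)
qed

lemma ordered_basis_cong:
  assumes "\<And>i. i < k \<Longrightarrow> e i = e' i" "ordered_basis k e S"
  shows "ordered_basis k e' S"
proof -
  have "e ` {..<k} = e' ` {..<k}" using assms(1) by (intro image_cong) auto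
  moreover have "inj_on e {..<k} = inj_on e' {..<k}" using assms(1) by (intro inj_on_cong) auto
  ultimately show ?thesis using assms(2) by (simp add: ordered_basis_def)
qed

section \<open>The image of the nilpotent endomorphism at a point\<close>

text \<open>The frame \<open>f\<close> is \<open>e I'\<close>, which absorbs \<open>\<epsilon>\<close>; rescaling its second half by \<open>\<mu>\<close> gives the
  frame in which \<open>N\<close> has the matrix \<open>\<Lambda>\<^sub>n\<close>.\<close>

locale related_pair =
  fixes n :: nat and T :: "'v::real_vector set" and h :: "'v \<Rightarrow> 'v \<Rightarrow> real"
    and J N :: "'v \<Rightarrow> 'v" and f :: "nat \<Rightarrow> 'v" and \<mu> :: real
  assumes n_pos: "n > 0" and \<mu> [simp]: "\<mu> * \<mu> = 1"
    and T: "span (f ` {..<4*n}) = T"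
    and J_in: "v \<in> T \<Longrightarrow> J v \<in> T" and N_in: "v \<in> T \<Longrightarrow> N v \<in> T"
    and J_lin: "v \<in> T \<Longrightarrow> w \<in> T \<Longrightarrow> J (a *\<^sub>R v + b *\<^sub>R w) = a *\<^sub>R J v + b *\<^sub>R J w"
    and N_lin: "v \<in> T \<Longrightarrow> w \<in> T \<Longrightarrow> N (a *\<^sub>R v + b *\<^sub>R w) = a *\<^sub>R N v + b *\<^sub>R N w"
    and h_lin: "u \<in> T \<Longrightarrow> v \<in> T \<Longrightarrow> w \<in> T \<Longrightarrow> h (a *\<^sub>R u + b *\<^sub>R v) w = a * h u w + b * h v w"
    and h_sym: "u \<in> T \<Longrightarrow> v \<in> T \<Longrightarrow> h u v = h v u"
    and h_J: "u \<in> T \<Longrightarrow> v \<in> T \<Longrightarrow> h (J u) (J v) = - h u v"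
    and h_f: "i < 4*n \<Longrightarrow> j < 2*n \<Longrightarrow> h (f i) (f j) = (if i = j then 1 else 0)"
    and J_f: "j < n \<Longrightarrow> J (f j) = f (2*n+j)" "j < n \<Longrightarrow> J (f (n+j)) = - f (3*n+j)"
      "j < n \<Longrightarrow> J (f (2*n+j)) = f j" "j < n \<Longrightarrow> J (f (3*n+j)) = - f (n+j)"
    and N_f: "j < n \<Longrightarrow> N (f j) = f (n+j) + \<mu> *\<^sub>R f (3*n+j)"
      "j < n \<Longrightarrow> N (f (n+j)) = - f j + \<mu> *\<^sub>R f (2*n+j)"
      "j < n \<Longrightarrow> N (f (2*n+j)) = \<mu> *\<^sub>R f (n+j) + f (3*n+j)"
      "j < n \<Longrightarrow> N (f (3*n+j)) = \<mu> *\<^sub>R f j - f (2*n+j)"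
begin

section \<open>Linearity of \<open>J\<close> and \<open>N\<close>, and induction over the
  frame\<close>

lemma subspace_T: "subspace T"
  using T subspace_span by metis

lemma f_in: "i < 4*n \<Longrightarrow> f i \<in> T"
  using T span_base[of "f i" "f ` {..<4*n}"] by auto

text \<open>The vectors of \<open>T\<close> satisfying \<open>Q\<close> form a subspace containing
  the frame, hence all of \<open>T\<close>. The case \<open>comb\<close> carries membership in
  \<open>T\<close> because \<open>J\<close> and \<open>N\<close> are linear only there; the other
  four cases match the four blocks of the matrices.\<close>

lemma T_induct [consumes 1, case_names comb f1 f2 f3 f4]:
  assumes "w \<in> T"
    and comb: "\<And>u v a b. u \<in> T \<Longrightarrow> v \<in> T \<Longrightarrow> Q u \<Longrightarrow> Q v \<Longrightarrow> Q (a *\<^sub>R u + b *\<^sub>R v)"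
    and f: "\<And>j. j < n \<Longrightarrow> Q (f j)" "\<And>j. j < n \<Longrightarrow> Q (f (n+j))"
      "\<And>j. j < n \<Longrightarrow> Q (f (2*n+j))" "\<And>j. j < n \<Longrightarrow> Q (f (3*n+j))"
  shows "Q w"
proof -
  have Qf: "Q (f i)" if "i < 4*n" for i
  proof -
    have "i < n \<or> (\<exists>j<n. i = n+j) \<or> (\<exists>j<n. i = 2*n+j) \<or> (\<exists>j<n. i = 3*n+j)"
      using that by presburger
    then show ?thesis using f by blast
  qed
  have "subspace {w \<in> T. Q w}"
  proof (rule subspaceI)
    show "0 \<in> {w \<in> T. Q w}"
      \<comment> \<open>Zero arises as a trivial combination of \<open>f 0\<close>, a frame member
        because \<open>n > 0\<close>.\<close>
      using comb[of "f 0" "f 0" 0 0] f_in[of 0] Qf[of 0] n_pos subspace_T by (auto simp: subspace_0)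
    show "x + y \<in> {w \<in> T. Q w}" if "x \<in> {w \<in> T. Q w}" "y \<in> {w \<in> T. Q w}" for x y
      using that comb[of x y 1 1] subspace_T by (auto simp: subspace_add)
    show "c *\<^sub>R x \<in> {w \<in> T. Q w}" if "x \<in> {w \<in> T. Q w}" for x c
      using that comb[of x x c 0] subspace_T by (auto simp: subspace_scale)
  qed
  then have "span (f ` {..<4*n}) \<subseteq> {w \<in> T. Q w}"
    using Qf f_in by (intro span_minimal) auto
  then show ?thesis using assms(1) T by auto
qed

lemma J_N_scaleR: "v \<in> T \<Longrightarrow> J (a *\<^sub>R v) = a *\<^sub>R J v" "v \<in> T \<Longrightarrow> N (a *\<^sub>R v) = a *\<^sub>R N v"
  using J_lin[of v v a 0] N_lin[of v v a 0] by auto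

lemma J_N_add: "v \<in> T \<Longrightarrow> w \<in> T \<Longrightarrow> J (v + w) = J v + J w"
  "v \<in> T \<Longrightarrow> w \<in> T \<Longrightarrow> N (v + w) = N v + N w"
  using J_lin[of v w 1 1] N_lin[of v w 1 1] by auto

lemma J_N_diff: "v \<in> T \<Longrightarrow> w \<in> T \<Longrightarrow> J (v - w) = J v - J w"
  "v \<in> T \<Longrightarrow> w \<in> T \<Longrightarrow> N (v - w) = N v - N w"
  using J_lin[of v w 1 "-1"] N_lin[of v w 1 "-1"] by auto

lemma J_N_uminus: "v \<in> T \<Longrightarrow> J (- v) = - J v" "v \<in> T \<Longrightarrow> N (- v) = - N v"
  using J_N_scaleR[of v "-1"] by auto

lemmas linear_simps = J_N_scaleR J_N_add J_N_diff J_N_uminus J_f N_f f_in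
  subspace_T subspace_add subspace_diff subspace_neg subspace_scale

section \<open>The image of \<open>N\<close> as an isotropic eigenspace of \<open>J\<close>\<close>

text \<open>For instance, \<open>J\<close> sends
  \<open>N (f j) = f (n+j) + \<mu> *\<^sub>R f (3*n+j)\<close> to
  \<open>- f (3*n+j) - \<mu> *\<^sub>R f (n+j)\<close>, which is -\<mu> times the original since
  \<mu> squares to 1. The other blocks are alike.\<close>

lemma J_N:
  assumes "w \<in> T" shows "J (N w) = - \<mu> *\<^sub>R N w"
  using assms
proof (induction rule: T_induct)
  case (comb u v a b)
  then show ?case by (simp add: N_lin J_lin N_in algebra_simps)
qed (simp_all add: linear_simps scaleR_right_distrib scaleR_right_diff_distrib)

lemma N_N:
  assumes "w \<in> T" shows "N (N w) = 0"
  using assms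
proof (induction rule: T_induct)
  case (comb u v a b)
  then show ?case by (simp add: N_lin J_lin N_in algebra_simps)
qed (simp_all add: linear_simps scaleR_right_distrib scaleR_right_diff_distrib)

lemma subspace_image: "subspace (N ` T)"
proof (rule subspaceI)
  show "0 \<in> N ` T"
    using J_N_scaleR(2)[of 0 0] subspace_0[OF subspace_T] by force
  show "x + y \<in> N ` T" if "x \<in> N ` T" "y \<in> N ` T" for x y
    using that J_N_add(2) subspace_add[OF subspace_T] by (smt (verit) imageE imageI)
  show "c *\<^sub>R x \<in> N ` T" if "x \<in> N ` T" for x c
    using that J_N_scaleR(2) subspace_scale[OF subspace_T] by (smt (verit) imageE imageI)
qed

text \<open>The vector is twice the projection of \<open>w\<close> onto the eigenspace of
  \<open>J\<close> for -\<mu>. Explicit preimages under \<open>N\<close> for the frame vectors show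
  that \<open>N\<close> reaches the whole eigenspace, without a count of dimensions.\<close>

lemma diff_J_in_image:
  assumes "w \<in> T" shows "w - \<mu> *\<^sub>R J w \<in> N ` T"
  using assms
proof (induction rule: T_induct)
  case (comb u v a b)
  have "a *\<^sub>R u + b *\<^sub>R v - \<mu> *\<^sub>R J (a *\<^sub>R u + b *\<^sub>R v) =
      a *\<^sub>R (u - \<mu> *\<^sub>R J u) + b *\<^sub>R (v - \<mu> *\<^sub>R J v)"
    using comb by (simp add: J_lin algebra_simps)
  then show ?case
    using comb subspace_image by (auto intro!: subspace_add subspace_scale)
next
  case (f1 j)
  then have "N (- f (n+j)) = f j - \<mu> *\<^sub>R J (f j)" by (simp add: linear_simps)
  moreover have "- f (n+j) \<in> T" using f1 by (simp add: linear_simps)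
  ultimately show ?case by force
next
  case (f2 j)
  then have "N (f j) = f (n+j) - \<mu> *\<^sub>R J (f (n+j))" by (simp add: linear_simps)
  moreover have "f j \<in> T" using f2 by (simp add: linear_simps)
  ultimately show ?case by force
next
  case (f3 j)
  then have "N (- f (3*n+j)) = f (2*n+j) - \<mu> *\<^sub>R J (f (2*n+j))" by (simp add: linear_simps)
  moreover have "- f (3*n+j) \<in> T" using f3 by (simp add: linear_simps)
  ultimately show ?case by force
next
  case (f4 j)
  then have "N (f (2*n+j)) = f (3*n+j) - \<mu> *\<^sub>R J (f (3*n+j))" by (simp add: linear_simps)
  moreover have "f (2*n+j) \<in> T" using f4 by (simp add: linear_simps)
  ultimately show ?case by force
qed

text \<open>This describes the image by \<open>J\<close> and \<mu> alone, so that membership can be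
  tested by an eigenvector equation, which behaves well under covariant differentiation.\<close>

lemma image_eq: "N ` T = {v \<in> T. J v = - \<mu> *\<^sub>R v}"
proof
  show "N ` T \<subseteq> {v \<in> T. J v = - \<mu> *\<^sub>R v}" using J_N N_in by auto
  show "{v \<in> T. J v = - \<mu> *\<^sub>R v} \<subseteq> N ` T"
  proof safe
    fix v assume v: "v \<in> T" "J v = - \<mu> *\<^sub>R v"
    \<comment> \<open>On this eigenspace \<open>\<mu> *\<^sub>R J v = - v\<close>, so the difference
      is \<open>2 *\<^sub>R v\<close>.\<close>
    have "v = (1/2) *\<^sub>R (v - \<mu> *\<^sub>R J v)"
      using v \<mu> by (simp flip: scaleR_2)
    then show "v \<in> N ` T"
      using diff_J_in_image[OF v(1)] subspace_scale[OF subspace_image] by metis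
  qed
qed

text \<open>On the eigenspace \<open>J\<close> multiplies both arguments by -\<mu>, which leaves
  \<open>h v w\<close> unchanged, whereas \<open>h_J\<close> reverses its sign.\<close>

lemma image_isotropic:
  assumes "v \<in> N ` T" "w \<in> N ` T"
  shows "h v w = 0"
proof -
  have v: "v \<in> T" "J v = - \<mu> *\<^sub>R v" and w: "w \<in> T" "J w = - \<mu> *\<^sub>R w"
    using assms by (auto simp: image_eq)
  have scale: "h (c *\<^sub>R x) y = c * h x y" if "x \<in> T" "y \<in> T" for c x y
    using that h_lin[of x x y c 0] by simp
  have "h (J v) (J w) = h v w"
    using v w subspace_T scale h_sym
    \<comment> \<open>Symmetry moves the second scalar into the first slot, where
      \<open>scale\<close> applies; the deleted rule would pull the minus sign out of the scalar and
      block this.\<close>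
    by (simp add: subspace_scale scale h_sym[of v "(- \<mu>) *\<^sub>R w"] del: scaleR_minus_left)
  then show ?thesis using h_J[of v w] v w by simp
qed

section \<open>A basis of the image by duality\<close>

lemma h_sum:
  assumes "\<And>i. i \<in> A \<Longrightarrow> g i \<in> T" "w \<in> T"
  shows "h (\<Sum>i\<in>A. x i *\<^sub>R g i) w = (\<Sum>i\<in>A. x i * h (g i) w)"
proof -
  have h0: "h 0 w = 0" using h_lin[of w w w 0 0] assms by simp
  show ?thesis
    using assms(1)
  proof (induction A rule: infinite_finite_induct)
    case (insert j A)
    then have "(\<Sum>i\<in>A. x i *\<^sub>R g i) \<in> T"
      using subspace_T by (auto intro!: subspace_sum subspace_scale)
    then show ?case
      using insert h_lin[of "g j" "\<Sum>i\<in>A. x i *\<^sub>R g i" w "x j" 1] assms(2) by simp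
  qed (use h0 in auto)
qed

text \<open>The first half of the frame suffices for spanning: \<open>N\<close> maps
  \<open>f (2*n+j)\<close> to \<mu> times \<open>N (f j)\<close> and \<open>f (3*n+j)\<close> to
  -\<mu> times \<open>N (f (n+j))\<close>.\<close>

lemma basis_image: "ordered_basis (2*n) (\<lambda>i. N (f i)) (N ` T)"
proof -
  \<comment> \<open>\<open>t\<close> is dual under \<open>h\<close> to the vectors \<open>N (f i)\<close>, which yields their independence.\<close>
  define t where "t k = (if k < n then f (n+k) else - f (k-n))" for k
  have t_in: "t k \<in> T" if "k < 2*n" for k
    using that by (auto simp: t_def linear_simps)
  have h_uminus: "h v (- w) = - h v w" if "v \<in> T" "w \<in> T" for v w
    using that h_lin[of w w v "-1" 0] h_sym[of v w] h_sym[of v "-w"] subspace_T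
    by (simp add: subspace_neg)
  have h_uminus': "h (- v) w = - h v w" if "v \<in> T" "w \<in> T" for v w
    using that h_lin[of v v w "-1" 0] by simp
  have h_comb: "h (u + c *\<^sub>R v) w = h u w + c * h v w" "h (c *\<^sub>R v - u) w = c * h v w - h u w"
    if "u \<in> T" "v \<in> T" "w \<in> T" for u v w c
    using h_lin[of u v w 1 c] h_lin[of v u w c "-1"] that by simp_all
  \<comment> \<open>Each \<open>t k\<close> is up to sign one of the first \<open>2*n\<close> frame
    vectors, so only the component of \<open>N (f i)\<close> in that half contributes:
    \<open>f (n+i)\<close> for \<open>i < n\<close>, and \<open>- f (i-n)\<close> otherwise.\<close>
  have dual: "h (N (f i)) (t k) = (if i = k then 1 else 0)" if ik: "i < 2*n" "k < 2*n" for i k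
  proof (cases "i < n")
    case True
    then show ?thesis
      using ik by (auto simp: t_def N_f h_comb h_uminus linear_simps h_f)
  next
    case False
    then obtain j where j: "i = n + j" "j < n"
      using ik that[of "i - n"] by simp
    then show ?thesis
      using ik by (auto simp: t_def N_f h_comb h_uminus h_uminus' linear_simps h_f)
  qed
  have inj: "inj_on (\<lambda>i. N (f i)) {..<2*n}"
    by (rule inj_onI) (metis dual lessThan_iff zero_neq_one)
  have "independent ((\<lambda>i. N (f i)) ` {..<2*n})"
    unfolding dependent_finite[OF finite_imageI[OF finite_lessThan]]
  proof clarsimp
    fix u i assume i: "i < 2*n" "u (N (f i)) \<noteq> 0"
      and 0: "(\<Sum>v\<in>(\<lambda>i. N (f i)) ` {..<2*n}. u v *\<^sub>R v) = 0"
    have "(\<Sum>k<2*n. u (N (f k)) *\<^sub>R N (f k)) = 0"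
      using 0 inj by (simp add: sum.reindex)
    then have "0 = h (\<Sum>k<2*n. u (N (f k)) *\<^sub>R N (f k)) (t i)"
      using h_lin[of "t i" "t i" "t i" 0 0] t_in i by simp
    also have "\<dots> = (\<Sum>k<2*n. u (N (f k)) * h (N (f k)) (t i))"
      using i by (intro h_sum) (auto simp: N_in f_in t_in)
    also have "\<dots> = (\<Sum>k<2*n. if k = i then u (N (f k)) else 0)"
      using i by (intro sum.cong) (auto simp: dual)
    also have "\<dots> = u (N (f i))" using i by simp
    finally show False using i by simp
  qed
  moreover have "span ((\<lambda>i. N (f i)) ` {..<2*n}) = N ` T"
  proof
    show "span ((\<lambda>i. N (f i)) ` {..<2*n}) \<subseteq> N ` T"
      using f_in by (intro span_minimal subspace_image) auto
    have base: "N (f i) \<in> span ((\<lambda>i. N (f i)) ` {..<2*n})" if "i < 2*n" for i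
      using that by (auto intro: span_base)
    show "N ` T \<subseteq> span ((\<lambda>i. N (f i)) ` {..<2*n})"
    proof safe
      fix w assume "w \<in> T"
      then show "N w \<in> span ((\<lambda>i. N (f i)) ` {..<2*n})"
      proof (induction rule: T_induct)
        case (comb u v a b)
        then show ?case by (auto simp: N_lin intro!: span_add span_scale)
      next
        case (f3 j)
        then have "N (f (2*n+j)) = \<mu> *\<^sub>R N (f j)" by (simp add: N_f scaleR_right_distrib)
        then show ?case using f3 base by (auto intro!: span_scale)
      next
        case (f4 j)
        then have "N (f (3*n+j)) = (-\<mu>) *\<^sub>R N (f (n+j))" by (simp add: N_f scaleR_right_diff_distrib)
        then show ?case using f4 base[of "n+j"] by (metis add_strict_left_mono mult_2 span_scale)
      qed (auto intro: base)
    qed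
  qed
  ultimately show ?thesis using inj by (simp add: ordered_basis_def)
qed

end

section \<open>The two matrices in an adapted frame\<close>

text \<open>Columns of the matrices at hand have at most two nonzero entries. Adding two indicator
  terms, instead of splitting cases, also covers a single entry, with \<open>y = 0\<close> and
  possibly \<open>a = b\<close>.\<close>

lemma row_mult_column:
  assumes "\<And>i. i < k \<Longrightarrow> A $$ (i, j) = (if i = a then x else 0) + (if i = b then y else 0)"
    and "a < k" "b < k"
  shows "row_mult k e A j p = x *\<^sub>R e a p + y *\<^sub>R e b p"
proof -
  have "row_mult k e A j p =
      (\<Sum>i<k. (if i = a then x *\<^sub>R e i p else 0) + (if i = b then y *\<^sub>R e i p else 0))"
    unfolding row_mult_def using assms(1) by (intro sum.cong) (auto simp: algebra_simps)
  also have "\<dots> = x *\<^sub>R e a p + y *\<^sub>R e b p"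
    using assms(2,3) by (simp add: sum.distrib)
  finally show ?thesis .
qed

text \<open>Counting from 0, the sign \<epsilon> occupies the first diagonal place of the fourth
  block, which is index \<open>3*n\<close>.\<close>

lemma row_mult_I'_sgn:
  assumes "j < 4*n"
  shows "row_mult (4*n) e (I'_sgn n \<epsilon>) j p = (if j = 3*n then \<epsilon> else 1) *\<^sub>R e j p"
proof -
  have "row_mult (4*n) e (I'_sgn n \<epsilon>) j p = (if j = 3*n then \<epsilon> else 1) *\<^sub>R e j p + 0 *\<^sub>R e j p"
    using assms by (intro row_mult_column) (auto simp: I'_sgn_def I_sgn_def)
  then show ?thesis by simp
qed

lemma row_mult_paracomplex_mat:
  assumes "j < n"
  shows "row_mult (4*n) e (paracomplex_mat n) j p = e (2*n+j) p"
    "row_mult (4*n) e (paracomplex_mat n) (n+j) p = - e (3*n+j) p"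
    "row_mult (4*n) e (paracomplex_mat n) (2*n+j) p = e j p"
    "row_mult (4*n) e (paracomplex_mat n) (3*n+j) p = - e (n+j) p"
proof -
  have "row_mult (4*n) e (paracomplex_mat n) j p = 1 *\<^sub>R e (2*n+j) p + 0 *\<^sub>R e j p"
    using assms by (intro row_mult_column) (auto simp: paracomplex_mat_def)
  then show "row_mult (4*n) e (paracomplex_mat n) j p = e (2*n+j) p" by simp
  have "row_mult (4*n) e (paracomplex_mat n) (n+j) p = (-1) *\<^sub>R e (3*n+j) p + 0 *\<^sub>R e j p"
    using assms by (intro row_mult_column) (auto simp: paracomplex_mat_def)
  then show "row_mult (4*n) e (paracomplex_mat n) (n+j) p = - e (3*n+j) p" by simp
  have "row_mult (4*n) e (paracomplex_mat n) (2*n+j) p = 1 *\<^sub>R e j p + 0 *\<^sub>R e j p"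
    using assms by (intro row_mult_column) (auto simp: paracomplex_mat_def)
  then show "row_mult (4*n) e (paracomplex_mat n) (2*n+j) p = e j p" by simp
  have "row_mult (4*n) e (paracomplex_mat n) (3*n+j) p = (-1) *\<^sub>R e (n+j) p + 0 *\<^sub>R e j p"
    using assms by (intro row_mult_column) (auto simp: paracomplex_mat_def)
  then show "row_mult (4*n) e (paracomplex_mat n) (3*n+j) p = - e (n+j) p" by simp
qed

lemma row_mult_Lambda_mat:
  assumes "j < n"
  shows "row_mult (4*n) e (Lambda_mat n) j p = e (n+j) p + e (3*n+j) p"
    "row_mult (4*n) e (Lambda_mat n) (n+j) p = - e j p + e (2*n+j) p"
    "row_mult (4*n) e (Lambda_mat n) (2*n+j) p = e (n+j) p + e (3*n+j) p"
    "row_mult (4*n) e (Lambda_mat n) (3*n+j) p = e j p - e (2*n+j) p"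
proof -
  have "row_mult (4*n) e (Lambda_mat n) j p = 1 *\<^sub>R e (n+j) p + 1 *\<^sub>R e (3*n+j) p"
    using assms by (intro row_mult_column) (auto simp: Lambda_mat_def)
  then show "row_mult (4*n) e (Lambda_mat n) j p = e (n+j) p + e (3*n+j) p" by simp
  have "row_mult (4*n) e (Lambda_mat n) (n+j) p = (-1) *\<^sub>R e j p + 1 *\<^sub>R e (2*n+j) p"
    using assms by (intro row_mult_column) (auto simp: Lambda_mat_def)
  then show "row_mult (4*n) e (Lambda_mat n) (n+j) p = - e j p + e (2*n+j) p" by simp
  have "row_mult (4*n) e (Lambda_mat n) (2*n+j) p = 1 *\<^sub>R e (n+j) p + 1 *\<^sub>R e (3*n+j) p"
    using assms by (intro row_mult_column) (auto simp: Lambda_mat_def)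
  then show "row_mult (4*n) e (Lambda_mat n) (2*n+j) p = e (n+j) p + e (3*n+j) p" by simp
  have "row_mult (4*n) e (Lambda_mat n) (3*n+j) p = 1 *\<^sub>R e j p + (-1) *\<^sub>R e (2*n+j) p"
    using assms by (intro row_mult_column) (auto simp: Lambda_mat_def)
  then show "row_mult (4*n) e (Lambda_mat n) (3*n+j) p = e j p - e (2*n+j) p" by simp
qed

text \<open>The matrix of \<open>J\<close> refers to the frame \<open>?f\<close>, that of
  \<open>N\<close> to \<open>?g\<close>. As both changes of frame are diagonal, \<open>?g\<close> is
  \<open>?f\<close> with its second half multiplied by \<mu>, which produces the factors \<mu> in
  the formulas for \<open>N\<close>.\<close>

lemma related_by_imp_related_pair:
  assumes h: "neutral_metric M n h" and J: "almost_eps_paracomplex M n h Or \<epsilon> J"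
    and n: "n > 0" and \<epsilon>: "\<epsilon> \<in> {1, -1}" and \<mu>: "\<mu> \<in> {1, -1}"
    and U: "openin (mtop M) U" and N: "endo_section M U N"
    and e: "related_by M n h Or \<epsilon> U N J e \<mu>" and p: "p \<in> U"
  shows "related_pair n (tangent_space M p) (h p) (J p) (N p)
    (\<lambda>i. row_mult (4*n) e (I'_sgn n \<epsilon>) i p) \<mu>"
proof -
  let ?T = "tangent_space M p"
  let ?f = "\<lambda>i. row_mult (4*n) e (I'_sgn n \<epsilon>) i p"
  let ?g = "\<lambda>i. row_mult (4*n) (frame_sgn n \<mu> e) (I'_sgn n \<epsilon>) i p"
  \<comment> \<open>These are the diagonal entries of \<open>I'_sgn n \<epsilon>\<close>; having
    square 1, they change neither the span nor the products under \<open>h\<close>.\<close>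
  define s where "s i = (if i = 3*n then \<epsilon> else 1)" for i
  have pM: "p \<in> topspace (mtop M)" using U p openin_subset by blast
  have ss: "s i * s i = 1" for i using \<epsilon> by (auto simp: s_def)
  have f: "?f i = s i *\<^sub>R e i p" if "i < 4*n" for i
    unfolding s_def by (rule row_mult_I'_sgn[OF that])
  have g: "?g i = (if i < 2*n then ?f i else \<mu> *\<^sub>R ?f i)" if "i < 4*n" for i
    using that by (simp add: row_mult_I'_sgn frame_sgn_def)
  have "ordered_basis (4*n) (\<lambda>i. e i p) ?T" and po: "pseudo_orthonormal n (h p) (\<lambda>i. e i p)"
    using e p by (auto simp: related_by_def adapted_frame_def po_frame_field_def frame_field_def)
  then have T: "span ((\<lambda>i. e i p) ` {..<4*n}) = ?T" by (simp add: ordered_basis_def)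
  then have sub: "subspace ?T" using subspace_span by metis
  have e_in: "e i p \<in> ?T" if "i < 4*n" for i
    using T span_base[of "e i p" "(\<lambda>i. e i p) ` {..<4*n}"] that by auto
  have f_in: "?f i \<in> ?T" if "i < 4*n" for i
    using that sub by (simp add: f e_in subspace_scale)
  have Tf: "span (?f ` {..<4*n}) = ?T"
  proof
    show "span (?f ` {..<4*n}) \<subseteq> ?T"
      using f_in by (intro span_minimal sub) auto
    have "e i p \<in> span (?f ` {..<4*n})" if "i < 4*n" for i
    proof -
      have "e i p = s i *\<^sub>R ?f i" using that by (simp add: f ss)
      moreover have "?f i \<in> span (?f ` {..<4*n})" using that by (intro span_base) auto
      ultimately show ?thesis using span_scale by metis
    qed
    then have "span ((\<lambda>i. e i p) ` {..<4*n}) \<subseteq> span (?f ` {..<4*n})"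
      by (intro span_minimal) auto
    then show "?T \<subseteq> span (?f ` {..<4*n})" by (simp add: T)
  qed
  have JE: "endo_section M (topspace (mtop M)) J"
    using J by (auto simp: almost_eps_paracomplex_def almost_paracomplex_def)
  have N_lin: "N p (a *\<^sub>R v + b *\<^sub>R w) = a *\<^sub>R N p v + b *\<^sub>R N p w" if "v \<in> ?T" "w \<in> ?T" for a b v w
    using N p that by (auto simp: endo_section_def)
  have h_lin: "h p (a *\<^sub>R u + b *\<^sub>R v) w = a * h p u w + b * h p v w"
    and h_sym: "h p u v = h p v u"
    if "u \<in> ?T" "v \<in> ?T" "w \<in> ?T" for a b u v w
    using h[unfolded neutral_metric_def, THEN conjunct1, rule_format, OF pM that] by simp_all
  have h_scale: "h p (a *\<^sub>R u) (b *\<^sub>R v) = a * b * h p u v" if "u \<in> ?T" "v \<in> ?T" for a b u v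
  proof -
    have 1: "h p (c *\<^sub>R x) y = c * h p x y" if "x \<in> ?T" "y \<in> ?T" for c x y
      using h_lin[of x x y c 0] that by simp
    have bv: "b *\<^sub>R v \<in> ?T" using sub that by (simp add: subspace_scale)
    have "h p (a *\<^sub>R u) (b *\<^sub>R v) = a * h p (b *\<^sub>R v) u"
      using 1[OF that(1) bv] h_sym[OF that(1) bv bv] by simp
    then show ?thesis using 1[OF that(2,1)] h_sym[OF that that(1)] by simp
  qed
  have Jf: "J p (?f j) = row_mult (4*n) (row_mult (4*n) e (I'_sgn n \<epsilon>)) (paracomplex_mat n) j p"
    and Ng: "N p (?g j) =
      row_mult (4*n) (row_mult (4*n) (frame_sgn n \<mu> e) (I'_sgn n \<epsilon>)) (Lambda_mat n) j p"
    if "j < 4*n" for j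
    using e p that by (auto simp: related_by_def adapted_frame_def)
  have \<mu>2: "\<mu> * \<mu> = 1" using \<mu> by auto
  have Nf: "N p (?f j) = \<mu> *\<^sub>R N p (?g j)" if "2*n \<le> j" "j < 4*n" for j
  proof -
    have "N p (\<mu> *\<^sub>R ?f j) = \<mu> *\<^sub>R N p (?f j)" using N_lin[of "?f j" "?f j" \<mu> 0] f_in that by simp
    then show ?thesis using that by (simp add: g \<mu>2)
  qed
  have Nf': "N p (?f j) = N p (?g j)" if "j < 2*n" for j
    using that by (simp add: g)
  show ?thesis
  proof
    show "h p (?f i) (?f j) = (if i = j then 1 else 0)" if "i < 4*n" "j < 2*n" for i j
    proof -
      have "h p (?f i) (?f j) = s i * s j * h p (e i p) (e j p)"
        using that by (simp add: f h_scale e_in)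
      also have "h p (e i p) (e j p) = (if i = j then 1 else 0)"
        using po that by (simp add: pseudo_orthonormal_def)
      finally show ?thesis by (simp add: ss)
    qed
    show "h p (J p u) (J p v) = - h p u v" if "u \<in> ?T" "v \<in> ?T" for u v
      using J pM that by (auto simp: almost_eps_paracomplex_def)
    show "J p v \<in> ?T" if "v \<in> ?T" for v
      using JE pM that by (auto simp: endo_section_def)
    show "N p v \<in> ?T" if "v \<in> ?T" for v
      using N p that by (auto simp: endo_section_def)
    show "J p (a *\<^sub>R v + b *\<^sub>R w) = a *\<^sub>R J p v + b *\<^sub>R J p w" if "v \<in> ?T" "w \<in> ?T" for a b v w
      using JE pM that by (auto simp: endo_section_def)
    show "J p (?f j) = ?f (2*n+j)" "J p (?f (n+j)) = - ?f (3*n+j)"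
      "J p (?f (2*n+j)) = ?f j" "J p (?f (3*n+j)) = - ?f (n+j)" if "j < n" for j
      using that by (simp_all add: Jf row_mult_paracomplex_mat)
    \<comment> \<open>First \<open>N\<close> is evaluated by the columns of
      \<open>Lambda_mat n\<close> in the frame \<open>?g\<close>; then \<open>?g\<close> is
      rewritten in terms of \<open>?f\<close>.\<close>
    show "N p (?f j) = ?f (n+j) + \<mu> *\<^sub>R ?f (3*n+j)"
      "N p (?f (n+j)) = - ?f j + \<mu> *\<^sub>R ?f (2*n+j)"
      "N p (?f (2*n+j)) = \<mu> *\<^sub>R ?f (n+j) + ?f (3*n+j)"
      "N p (?f (3*n+j)) = \<mu> *\<^sub>R ?f j - ?f (2*n+j)" if "j < n" for j
      using that
      by (simp_all add: Nf Nf' Ng row_mult_Lambda_mat scaleR_right_distrib scaleR_right_diff_distrib)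
        (simp_all add: g \<mu>2)
  qed (use n \<mu>2 Tf N_lin h_lin h_sym in auto)
qed

section \<open>The Walker property\<close>

locale nabla_paracomplex =
  fixes M :: "('a, 'b::euclidean_space) smooth_mfd"
    and n :: nat
    and h :: "'a \<Rightarrow> 'a tvec \<Rightarrow> 'a tvec \<Rightarrow> real"
    and Or :: "'a \<Rightarrow> (nat \<Rightarrow> 'a tvec) set"
    and nab :: "'a connection"
    and \<epsilon> :: real
    and J :: "'a \<Rightarrow> 'a tvec \<Rightarrow> 'a tvec"
  assumes mfd: "smooth_manifold M" and n_pos: "n > 0"
    and metric: "neutral_metric M n h"
    and conn: "affine_connection M nab"
    and \<epsilon>: "\<epsilon> \<in> {1, -1}"
    and J: "almost_eps_paracomplex M n h Or \<epsilon> J"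
begin

lemma J_endo: "endo_section M (topspace (mtop M)) J"
  using J by (auto simp: almost_eps_paracomplex_def almost_paracomplex_def)

text \<open>A single sign \<mu> serves all points of \<open>U\<close>. The eigenvalue -\<mu> is
  therefore constant there and can be differentiated as a constant.\<close>

lemma nabla_repr_frame:
  assumes "nabla_repr M n h Or nab \<epsilon> J U \<alpha> N"
  obtains e \<mu> where "\<mu> \<in> {1, -1}" "\<And>i. i < 4*n \<Longrightarrow> smooth_vfield M U (e i)"
    "\<And>p. p \<in> U \<Longrightarrow> related_pair n (tangent_space M p) (h p) (J p) (N p)
      (\<lambda>i. row_mult (4*n) e (I'_sgn n \<epsilon>) i p) \<mu>"
proof -
  obtain e \<mu> where e: "\<mu> \<in> {1, -1}" "related_by M n h Or \<epsilon> U N J e \<mu>"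
    using assms unfolding nabla_repr_def by blast
  have "openin (mtop M) U" "endo_section M U N"
    using assms by (auto simp: nabla_repr_def almost_nilpotent_def)
  then show thesis
    using that[of \<mu> e] e related_by_imp_related_pair[OF metric J n_pos \<epsilon>]
    by (auto simp: related_by_def adapted_frame_def po_frame_field_def frame_field_def)
qed

text \<open>At a vector \<open>v\<close> with \<open>\<alpha> p v \<noteq> 0\<close>, the two
  representations of the derivative of \<open>J\<close> along \<open>v\<close> give
  \<open>N p = c *\<^sub>R N' p\<close> on the tangent space.\<close>

lemma nabla_repr_image_subset:
  assumes 1: "nabla_repr M n h Or nab \<epsilon> J U \<alpha> N" "p \<in> U"
    and 2: "nabla_repr M n h Or nab \<epsilon> J U' \<alpha>' N'" "p \<in> U'"
  shows "N p ` tangent_space M p \<subseteq> N' p ` tangent_space M p"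
proof -
  let ?T = "tangent_space M p"
  obtain e \<mu> where e: "\<And>i. i < 4*n \<Longrightarrow> smooth_vfield M U (e i)"
    "\<And>p. p \<in> U \<Longrightarrow> related_pair n (tangent_space M p) (h p) (J p) (N p)
      (\<lambda>i. row_mult (4*n) e (I'_sgn n \<epsilon>) i p) \<mu>"
    using nabla_repr_frame[OF 1(1)] by metis
  obtain e' \<mu>' where e':
    "\<And>p. p \<in> U' \<Longrightarrow> related_pair n (tangent_space M p) (h p) (J p) (N' p)
      (\<lambda>i. row_mult (4*n) e' (I'_sgn n \<epsilon>) i p) \<mu>'"
    using nabla_repr_frame[OF 2(1)] by metis
  interpret R: related_pair n ?T "h p" "J p" "N p" "\<lambda>i. row_mult (4*n) e (I'_sgn n \<epsilon>) i p" \<mu>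
    by (rule e(2)[OF 1(2)])
  interpret R': related_pair n ?T "h p" "J p" "N' p" "\<lambda>i. row_mult (4*n) e' (I'_sgn n \<epsilon>) i p" \<mu>'
    by (rule e'[OF 2(2)])
  obtain v where v: "v \<in> ?T" "\<alpha> p v \<noteq> 0"
    using 1 by (auto simp: nabla_repr_def nowhere_zero_def)
  define c where "c = \<alpha>' p v / \<alpha> p v"
  \<comment> \<open>The representations are stated for vector fields smooth near \<open>p\<close>.
    The frame fields supply such extensions of a basis, and linearity does the rest.\<close>
  have e_eq: "N p (e i p) = c *\<^sub>R N' p (e i p)" if "i < 4*n" for i
  proof -
    have "smooth_vfield_at M p (e i)"
      using e(1)[OF that] 1 by (auto simp: smooth_vfield_at_def nabla_repr_def)
    then have "\<alpha> p v *\<^sub>R N p (e i p) = \<alpha>' p v *\<^sub>R N' p (e i p)"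
      using 1 2 v(1) unfolding nabla_repr_def by metis
    then have "inverse (\<alpha> p v) *\<^sub>R \<alpha> p v *\<^sub>R N p (e i p) = inverse (\<alpha> p v) *\<^sub>R \<alpha>' p v *\<^sub>R N' p (e i p)"
      by simp
    then show ?thesis using v(2) by (simp add: c_def field_simps)
  qed
  have e_in: "e i p \<in> ?T" if "i < 4*n" for i
    using e(1)[OF that] 1(2) by (auto simp: smooth_vfield_def)
  have f: "N p (row_mult (4*n) e (I'_sgn n \<epsilon>) i p) = c *\<^sub>R N' p (row_mult (4*n) e (I'_sgn n \<epsilon>) i p)"
    if "i < 4*n" for i
    using that by (simp add: row_mult_I'_sgn R.J_N_scaleR R'.J_N_scaleR e_in e_eq)
  have "N p w = c *\<^sub>R N' p w" if "w \<in> ?T" for w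
    using that
  proof (induction rule: R.T_induct)
    case (comb u v a b)
    then show ?case
      by (simp only: R.N_lin R'.N_lin scaleR_right_distrib scaleR_scaleR mult.commute)
  qed (use f in auto)
  then show ?thesis
    using subspace_scale[OF R'.subspace_image] by auto
qed

lemma nabla_distribution_eq:
  assumes "nabla_repr M n h Or nab \<epsilon> J U \<alpha> N" "p \<in> U"
  shows "nabla_distribution M n h Or nab \<epsilon> J p = N p ` tangent_space M p"
proof
  show "nabla_distribution M n h Or nab \<epsilon> J p \<subseteq> N p ` tangent_space M p"
    unfolding nabla_distribution_def using nabla_repr_image_subset[OF _ _ assms] by blast
  show "N p ` tangent_space M p \<subseteq> nabla_distribution M n h Or nab \<epsilon> J p"
    unfolding nabla_distribution_def using assms by blast
qed

text \<open>Since \<open>N p (W p) = 0\<close>, \<open>J\<close> commutes with differentiating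
  \<open>W\<close> at \<open>p\<close>, and the constant \<open>c\<close> passes through
  \<open>nab\<close>. The eigenvector equation is required on a neighbourhood because it is
  differentiated, the vanishing only at \<open>p\<close>.\<close>

lemma nabla_section_in_eigenspace:
  assumes R: "nabla_repr M n h Or nab \<epsilon> J U \<alpha> N" and p: "p \<in> U" and v: "v \<in> tangent_space M p"
    and V: "openin (mtop M) V" "p \<in> V" and W: "smooth_vfield M V W"
    and JW: "\<And>q. q \<in> V \<Longrightarrow> J q (W q) = c *\<^sub>R W q" and NW: "N p (W p) = 0"
  shows "J p (nab p v W) = c *\<^sub>R nab p v W"
proof -
  have pM: "p \<in> topspace (mtop M)" and VM: "V \<subseteq> topspace (mtop M)"
    using V openin_subset by blast+
  have JWs: "smooth_vfield M V (\<lambda>q. J q (W q))"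
    using J_endo V W VM unfolding endo_section_def by blast
  \<comment> \<open>Smoothness is inherited from \<open>J W\<close>, which coincides with this field
    on \<open>V\<close>.\<close>
  have cWs: "smooth_vfield M V (\<lambda>q. c *\<^sub>R W q)"
    by (rule smooth_vfield_cong[OF mfd _ JWs]) (simp add: JW)
  have at: "smooth_vfield_at M p W" "smooth_vfield_at M p (\<lambda>q. J q (W q))"
    "smooth_vfield_at M p (\<lambda>q. c *\<^sub>R W q)"
    using V W JWs cWs unfolding smooth_vfield_at_def by blast+
  have "agree_near M p (\<lambda>q. J q (W q)) (\<lambda>q. c *\<^sub>R W q)"
    using V JW unfolding agree_near_def by blast
  then have 1: "nab p v (\<lambda>q. J q (W q)) = nab p v (\<lambda>q. c *\<^sub>R W q)"
    using conn[unfolded affine_connection_def, THEN conjunct2, THEN conjunct1] pM v at by simp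
  have const: "smooth_fun_at M p (\<lambda>q. a)" for a
    using V smooth_fun_const unfolding smooth_fun_at_def by blast
  have leibniz: "nab p v (\<lambda>q. f q *\<^sub>R W q) = v f *\<^sub>R W p + f p *\<^sub>R nab p v W"
    if "smooth_fun_at M p f" for f
    using conn[unfolded affine_connection_def, THEN conjunct2, THEN conjunct2, THEN conjunct2,
        THEN conjunct2, THEN conjunct1] pM v at(1) that by simp
  \<comment> \<open>Derivations annihilate constants: the product rule for 1 = 1 * 1 forces the
    value 0 at the constant 1, and homogeneity extends this to \<open>c\<close>.\<close>
  have 2: "v (\<lambda>q. c) = 0"
  proof -
    note derivation = v[unfolded tangent_space_def mem_Collect_eq, THEN conjunct2, THEN conjunct2]
    have "v (\<lambda>q. 1 * 1) = 1 * v (\<lambda>q. 1) + 1 * v (\<lambda>q. 1)"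
      using derivation[THEN conjunct1, rule_format, OF conjI[OF const const]] by fast
    moreover have "v (\<lambda>q. c * 1) = c * v (\<lambda>q. 1)"
      using derivation[THEN conjunct2, rule_format, OF const] .
    ultimately show ?thesis by simp
  qed
  have "covD_endo nab J p v W = 0"
    using R p v at(1) NW by (simp add: nabla_repr_def)
  then have "J p (nab p v W) = nab p v (\<lambda>q. J q (W q))"
    by (simp add: covD_endo_def)
  then show ?thesis using 1 2 leibniz[OF const[of c]] by simp
qed

lemma walker_nabla_distribution:
  assumes repr: "\<forall>p\<in>topspace (mtop M). \<exists>U \<alpha> N. p \<in> U \<and> nabla_repr M n h Or nab \<epsilon> J U \<alpha> N"
  shows "walker_manifold M n h nab (nabla_distribution M n h Or nab \<epsilon> J)"
    (is "walker_manifold M n h nab ?D")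
  unfolding walker_manifold_def
proof (intro conjI allI impI ballI)
  show "distribution M (2*n) ?D"
    unfolding distribution_def
  proof
    fix p assume "p \<in> topspace (mtop M)"
    then obtain U \<alpha> N where R: "p \<in> U" "nabla_repr M n h Or nab \<epsilon> J U \<alpha> N"
      using repr by blast
    obtain e \<mu> where e: "\<And>i. i < 4*n \<Longrightarrow> smooth_vfield M U (e i)"
      "\<And>p. p \<in> U \<Longrightarrow> related_pair n (tangent_space M p) (h p) (J p) (N p)
        (\<lambda>i. row_mult (4*n) e (I'_sgn n \<epsilon>) i p) \<mu>"
      using nabla_repr_frame[OF R(2)] by metis
    have U: "openin (mtop M) U" and N: "endo_section M U N"
      using R by (auto simp: nabla_repr_def almost_nilpotent_def)
    \<comment> \<open>The fields \<open>e i\<close> can replace the members of \<open>e I'\<close>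
      because \<epsilon> affects only index \<open>3*n\<close>, outside the first
      \<open>2*n\<close>.\<close>
    have "local_generators M U (2*n) (\<lambda>i q. N q (e i q)) ?D"
      unfolding local_generators_def
    proof (intro conjI allI impI ballI)
      fix i assume "i < 2*n"
      then have "smooth_vfield M U (e i)" using e(1) by simp
      then show "smooth_vfield M U (\<lambda>q. N q (e i q))"
        using N U unfolding endo_section_def by blast
    next
      fix q assume q: "q \<in> U"
      have "ordered_basis (2*n) (\<lambda>i. N q (row_mult (4*n) e (I'_sgn n \<epsilon>) i q)) (?D q)"
        using related_pair.basis_image[OF e(2)[OF q]] nabla_distribution_eq[OF R(2) q] by simp
      moreover have "N q (row_mult (4*n) e (I'_sgn n \<epsilon>) i q) = N q (e i q)" if "i < 2*n" for i
        using that by (simp add: row_mult_I'_sgn)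
      ultimately show "ordered_basis (2*n) (\<lambda>i. N q (e i q)) (?D q)"
        by (rule ordered_basis_cong[rotated])
    qed (rule U)
    then show "\<exists>U \<xi>. p \<in> U \<and> local_generators M U (2*n) \<xi> ?D" using R(1) by blast
  qed
next
  show "light_like M h ?D"
    unfolding light_like_def
  proof
    fix p assume "p \<in> topspace (mtop M)"
    then obtain U \<alpha> N where R: "p \<in> U" "nabla_repr M n h Or nab \<epsilon> J U \<alpha> N"
      using repr by blast
    obtain e \<mu> where e: "related_pair n (tangent_space M p) (h p) (J p) (N p)
        (\<lambda>i. row_mult (4*n) e (I'_sgn n \<epsilon>) i p) \<mu>"
      using nabla_repr_frame[OF R(2)] R(1) by metis
    show "\<forall>v\<in>?D p. \<forall>w\<in>?D p. h p v w = 0"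
      unfolding nabla_distribution_eq[OF R(2,1)] using related_pair.image_isotropic[OF e] by blast
  qed
next
  fix V \<xi> p v and i :: nat
  assume gen: "local_generators M V (2*n) \<xi> ?D" and p: "p \<in> V"
    and v: "v \<in> tangent_space M p" and i: "i < 2*n"
  have V: "openin (mtop M) V" and \<xi>: "smooth_vfield M V (\<xi> i)"
    and basis: "\<And>q. q \<in> V \<Longrightarrow> ordered_basis (2*n) (\<lambda>i. \<xi> i q) (?D q)"
    using gen i by (auto simp: local_generators_def)
  have \<xi>D: "\<xi> i q \<in> ?D q" if "q \<in> V" for q
    using basis[OF that] i span_base[of "\<xi> i q" "(\<lambda>i. \<xi> i q) ` {..<2*n}"]
    by (auto simp: ordered_basis_def)
  have pM: "p \<in> topspace (mtop M)" using V p openin_subset by blast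
  then obtain U \<alpha> N where R: "p \<in> U" "nabla_repr M n h Or nab \<epsilon> J U \<alpha> N"
    using repr by blast
  obtain e \<mu> where e: "\<And>p. p \<in> U \<Longrightarrow> related_pair n (tangent_space M p) (h p) (J p) (N p)
      (\<lambda>i. row_mult (4*n) e (I'_sgn n \<epsilon>) i p) \<mu>"
    using nabla_repr_frame[OF R(2)] by metis
  have D: "?D q = N q ` tangent_space M q" if "q \<in> U" for q
    using nabla_distribution_eq[OF R(2) that] .
  \<comment> \<open>Arbitrary generators are treated, not only those built from \<open>N\<close>: on
    the overlap of \<open>U\<close> and \<open>V\<close> each one is a section of the eigenspace for
    -\<mu>.\<close>
  have "J p (nab p v (\<xi> i)) = - \<mu> *\<^sub>R nab p v (\<xi> i)"
  proof (rule nabla_section_in_eigenspace[OF R(2,1) v])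
    show "openin (mtop M) (U \<inter> V)" using V R(2) by (auto simp: nabla_repr_def)
    show "smooth_vfield M (U \<inter> V) (\<xi> i)" using \<xi> smooth_vfield_subset by blast
    show "J q (\<xi> i q) = - \<mu> *\<^sub>R \<xi> i q" if "q \<in> U \<inter> V" for q
      using that \<xi>D[of q] D[of q] related_pair.image_eq[OF e[of q]] by auto
    show "N p (\<xi> i p) = 0"
      using \<xi>D[OF p] D[OF R(1)] related_pair.N_N[OF e[OF R(1)]] by auto
  qed (use p R(1) in auto)
  moreover have "smooth_vfield_at M p (\<xi> i)"
    using V p \<xi> by (auto simp: smooth_vfield_at_def)
  then have "nab p v (\<xi> i) \<in> tangent_space M p"
    using conn[unfolded affine_connection_def, THEN conjunct1] pM v by simp
  ultimately show "nab p v (\<xi> i) \<in> ?D p"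
    using related_pair.image_eq[OF e[OF R(1)]] D[OF R(1)] by auto
qed

end

theorem theorem6p1:
  fixes M :: "('a, 'b::euclidean_space) smooth_mfd"
    and n :: nat
    and h :: "'a \<Rightarrow> 'a tvec \<Rightarrow> 'a tvec \<Rightarrow> real"
    and Or :: "'a \<Rightarrow> (nat \<Rightarrow> 'a tvec) set"
    and nab :: "'a connection"
    and \<epsilon> :: real
    and J :: "'a \<Rightarrow> 'a tvec \<Rightarrow> 'a tvec"
  assumes "smooth_manifold M" and "DIM('b) = 4 * n"
    and "orientation M (4 * n) Or"
    and "neutral_metric M n h"
    and "levi_civita M h nab"
    and "\<epsilon> \<in> {1, -1}"
    and "almost_eps_paracomplex M n h Or \<epsilon> J"
    and "\<forall>p\<in>topspace (mtop M). \<exists>U \<alpha> N. p \<in> U \<and> nabla_repr M n h Or nab \<epsilon> J U \<alpha> N"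
  shows "walker_manifold M n h nab (nabla_distribution M n h Or nab \<epsilon> J)"
proof -
  \<comment> \<open>A Euclidean space type has positive dimension, which excludes
    \<open>n = 0\<close>.\<close>
  have "n > 0" using assms(2) DIM_positive[where 'a='b] by linarith
  then interpret nabla_paracomplex M n h Or nab \<epsilon> J
    using assms by unfold_locales (auto simp: levi_civita_def)
  show ?thesis by (rule walker_nabla_distribution[OF assms(8)])
qed

end
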